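(* Let $\mathbb{K}$ be a field and let $I\subset \mathbb{K}[x_1,\ldots,x_n]$ be a graded coordinate-saturated ideal. Suppose that $I$ has a unique minimal prime containing none of the indeterminates $x_1,\dots,x_n$. Then this prime is necessarily $$\mathfrak{p}=\Big(I:\prod_{i\in[n]}x_i\Big).$$ Moreover, $\mathrm{v}_{\mathfrak{p}}(I)\leq \gamma(I)$, and equality $\mathrm{v}_{\mathfrak{p}}(I)=\gamma(I)$ holds whenever $I+M$ is radical and $\mathbb{K}$ is algebraically closed. In particular, if $\mathbb{K}$ is algebraically closed, the equality holds whenever $I$ is binomial.
   Context: $[n]=\{1,\dots,n\}$. The polynomial ring $R=\mathbb{K}[x_1,\ldots,x_n]$ has the standard grading $R=\bigoplus_d R_d$. For a graded ideal $I$ and $\mathfrak{p}\in\mathrm{Ass}(I)$, the local $\mathrm{v}$-number is $\mathrm{v}_{\mathfrak p}(I)=\min\{d\ge 0:\exists f\in R_d \text{ with } I:f=\mathfrak p\}$. An ideal is binomial if it is generated by polynomials with at most two terms. For a radical ideal $I$ and $S\subseteq[n]$ put $$P_S(I):=\Big((I+(x_i:i\in S)):\big(\textstyle\prod_{i\notin S}x_i\big)^{\infty}\Big).$$ A radical ideal $I\subseteq\mathbb{K}[x_1,\ldots,x_n]$ is called coordinate-saturated if every minimal prime of $I$ is of the form $P_S(I)$ for some $S\subseteq[n]$ and, for every $S$ such that $P_S(I)$ is a minimal prime of $I$, $$(I+(x_i:i\in S))\cap \mathbb{K}[x_i:i\notin S]=I\cap \mathbb{K}[x_i:i\notin S].$$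 Let $\min(I)$ be the set of minimal primes of $I$, and let $\mathfrak p$ be the unique minimal prime of $I$ containing no indeterminates. $M$ denotes the monomial ideal generated by all monomials contained in $\bigcap_{\mathfrak q\in\min(I)\setminus\{\mathfrak p\}}\mathfrak q$ (an empty intersection is the whole ring), and $\gamma(I):=\min\{\deg(x^u): x^u \text{ a monomial in } M\}$. *)

theory Defs
  imports "HOL-Algebra.Algebraic_Closure_Type" "HOL-Library.Poly_Mapping" "HOL-Library.Extended_Nat"
begin

section \<open>Polynomials in finitely many variables\<close>

text \<open>
  The variables are indexed by a finite type \<open>'n\<close>, so that \<open>n = CARD('n)\<close>. An exponent
  vector is a finitely supported map \<open>'n \<Rightarrow>\<^sub>0 nat\<close>, a polynomial a finitely supported map from
  exponent vectors to coefficients; multiplication is the convolution product.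
\<close>

type_synonym ('n, 'k) mpoly = "('n \<Rightarrow>\<^sub>0 nat) \<Rightarrow>\<^sub>0 'k"

abbreviation mpoly_ring :: "('n::finite, 'k::field) mpoly ring" where
  "mpoly_ring \<equiv> ring_of_type_algebra"

definition xmon :: "('n::finite \<Rightarrow>\<^sub>0 nat) \<Rightarrow> ('n, 'k::field) mpoly" where
  "xmon u = Poly_Mapping.single u 1"

definition Var :: "'n::finite \<Rightarrow> ('n, 'k::field) mpoly" where
  "Var i = xmon (Poly_Mapping.single i 1)"

definition mdeg :: "('n::finite \<Rightarrow>\<^sub>0 nat) \<Rightarrow> nat" where
  "mdeg u = (\<Sum>i\<in>UNIV. Poly_Mapping.lookup u i)"

text \<open>The graded piece \<open>R\<^sub>d\<close>; it contains \<open>0\<close> for every \<open>d\<close>.\<close>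

definition homogeneous :: "nat \<Rightarrow> ('n::finite, 'k::field) mpoly set" where
  "homogeneous d = {f. \<forall>u\<in>Poly_Mapping.keys f. mdeg u = d}"

definition hom_component :: "nat \<Rightarrow> ('n::finite, 'k::field) mpoly \<Rightarrow> ('n, 'k) mpoly" where
  "hom_component d f =
     (\<Sum>u\<in>{u \<in> Poly_Mapping.keys f. mdeg u = d}. Poly_Mapping.single u (Poly_Mapping.lookup f u))"

text \<open>The subring \<open>K[x\<^sub>i : i \<in> T]\<close>.\<close>

definition polys_in :: "'n set \<Rightarrow> ('n::finite, 'k::field) mpoly set" where
  "polys_in T = {f. \<forall>u\<in>Poly_Mapping.keys f. Poly_Mapping.keys u \<subseteq> T}"

section \<open>Ideals\<close>

definition graded_ideal :: "('n::finite, 'k::field) mpoly set \<Rightarrow> bool" where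
  "graded_ideal I \<longleftrightarrow> ideal I mpoly_ring \<and> (\<forall>f\<in>I. \<forall>d. hom_component d f \<in> I)"

definition radical_ideal :: "('n::finite, 'k::field) mpoly set \<Rightarrow> bool" where
  "radical_ideal I \<longleftrightarrow> ideal I mpoly_ring \<and> {f. \<exists>k>0. f ^ k \<in> I} = I"

definition binomial_ideal :: "('n::finite, 'k::field) mpoly set \<Rightarrow> bool" where
  "binomial_ideal I \<longleftrightarrow>
     (\<exists>G. (\<forall>g\<in>G. card (Poly_Mapping.keys g) \<le> 2) \<and> I = Idl\<^bsub>mpoly_ring\<^esub> G)"

definition colon :: "('n::finite, 'k::field) mpoly set \<Rightarrow> ('n, 'k) mpoly \<Rightarrow> ('n, 'k) mpoly set" where
  "colon I f = {g. g * f \<in> I}"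

definition saturation :: "('n::finite, 'k::field) mpoly set \<Rightarrow> ('n, 'k) mpoly \<Rightarrow> ('n, 'k) mpoly set" where
  "saturation I f = {g. \<exists>k. g * f ^ k \<in> I}"

definition minimal_primes :: "('n::finite, 'k::field) mpoly set \<Rightarrow> ('n, 'k) mpoly set set" where
  "minimal_primes I =
     {p. primeideal p mpoly_ring \<and> I \<subseteq> p \<and>
         (\<forall>q. primeideal q mpoly_ring \<longrightarrow> I \<subseteq> q \<longrightarrow> q \<subseteq> p \<longrightarrow> q = p)}"

definition Ass :: "('n::finite, 'k::field) mpoly set \<Rightarrow> ('n, 'k) mpoly set set" where
  "Ass I = {p. primeideal p mpoly_ring \<and> (\<exists>f. colon I f = p)}"

text \<open>\<open>I + (x\<^sub>i : i \<in> S)\<close>\<close>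

definition add_vars :: "('n::finite, 'k::field) mpoly set \<Rightarrow> 'n set \<Rightarrow> ('n, 'k) mpoly set" where
  "add_vars I S = I <+>\<^bsub>mpoly_ring\<^esub> (Idl\<^bsub>mpoly_ring\<^esub> (Var ` S))"

definition P_ideal :: "'n set \<Rightarrow> ('n::finite, 'k::field) mpoly set \<Rightarrow> ('n, 'k) mpoly set" where
  "P_ideal S I = saturation (add_vars I S) (\<Prod>i\<in>-S. Var i)"

definition coordinate_saturated :: "('n::finite, 'k::field) mpoly set \<Rightarrow> bool" where
  "coordinate_saturated I \<longleftrightarrow>
     radical_ideal I \<and>
     (\<forall>q\<in>minimal_primes I. \<exists>S. q = P_ideal S I) \<and>
     (\<forall>S. P_ideal S I \<in> minimal_primes I \<longrightarrow>
        add_vars I S \<inter> polys_in (-S) = I \<inter> polys_in (-S))"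

section \<open>The local v-number and the invariant \<open>\<gamma>\<close>\<close>

text \<open>Both minima are taken in \<^typ>\<open>enat\<close>, so that the minimum of the empty set is \<open>\<infinity>\<close>.\<close>

definition v_number :: "('n::finite, 'k::field) mpoly set \<Rightarrow> ('n, 'k) mpoly set \<Rightarrow> enat" where
  "v_number p I = (INF d\<in>{d. \<exists>f\<in>homogeneous d. colon I f = p}. enat d)"

text \<open>
  Below, \<open>p\<close> is meant to be the unique minimal prime of \<open>I\<close> without variables. If it is the only
  minimal prime, then the intersection is \<^const>\<open>UNIV\<close>, the whole ring.
\<close>

definition M_ideal :: "('n::finite, 'k::field) mpoly set \<Rightarrow> ('n, 'k) mpoly set \<Rightarrow> ('n, 'k) mpoly set" where
  "M_ideal p I = Idl\<^bsub>mpoly_ring\<^esub> {xmon u | u. xmon u \<in> \<Inter>(minimal_primes I - {p})}"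

definition gamma :: "('n::finite, 'k::field) mpoly set \<Rightarrow> ('n, 'k) mpoly set \<Rightarrow> enat" where
  "gamma p I = (INF u\<in>{u. xmon u \<in> M_ideal p I}. enat (mdeg u))"

text \<open>
  The class \<^class>\<open>alg_closed_field\<close> cannot serve as a hypothesis of only a part of a statement about
  a \<^class>\<open>field\<close>, hence this predicate on types.
\<close>

definition alg_closed_type :: "'k::field itself \<Rightarrow> bool" where
  "alg_closed_type _ \<longleftrightarrow> (\<forall>p :: 'k poly. Polynomial.degree p > 0 \<longrightarrow> (\<exists>z. poly p z = 0))"

end

theory Submission
  imports Defs
begin

text \<open>
  If \<open>I : f = p\<close>, then \<open>f\<close> lies in the intersection \<open>J\<close> of the minimal primes other than \<open>p\<close>.
  Once \<open>J \<subseteq> I + M\<close>, a form \<open>f\<close> of degree below \<open>\<gamma>(I)\<close> would lie in \<open>I\<close> by comparing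
  homogeneous components, which is absurd.

  Every prime over \<open>I + M\<close> contains some minimal prime other than \<open>p\<close>: coordinate saturation
  gives \<open>P\<^sub>S(I) \<subseteq> p + (x\<^sub>i : i \<in> S)\<close>. Hence \<open>J\<close> lies in the radical of
  \<open>I + M\<close>.

  For a radical binomial ideal \<open>I\<close> and a monomial ideal \<open>N\<close>, the radical of \<open>I + N\<close> is \<open>I\<close> plus a
  monomial ideal (cf. Eisenbud and Sturmfels, \<^emph>\<open>Binomial ideals\<close>). For \<open>N = M\<close> the monomials in this
  radical lie in \<open>J\<close>, hence in \<open>M\<close>, so \<open>J \<subseteq> I + M\<close> again.
\<close>

section \<open>Ideals of a commutative ring given by a type\<close>

text \<open>Bridge from the record-based ideals of HOL-Algebra to class arithmetic; closure under
  negation comes from multiplying by \<open>-1\<close>.\<close>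

lemma ideal_type_iff:
  "ideal I (ring_of_type_algebra :: 'a::comm_ring_1 ring) \<longleftrightarrow>
     0 \<in> I \<and> (\<forall>a\<in>I. \<forall>b\<in>I. a + b \<in> I) \<and> (\<forall>a\<in>I. \<forall>r. r * a \<in> I)"
proof
  assume "ideal I (ring_of_type_algebra :: 'a ring)"
  then interpret ideal I "ring_of_type_algebra :: 'a ring" .
  show "0 \<in> I \<and> (\<forall>a\<in>I. \<forall>b\<in>I. a + b \<in> I) \<and> (\<forall>a\<in>I. \<forall>r. r * a \<in> I)"
    using additive_subgroup.zero_closed[OF additive_subgroup_axioms]
      additive_subgroup.a_closed[OF additive_subgroup_axioms] I_l_closed
    by (simp add: ring_of_type_algebra_def)
next
  let ?R = "ring_of_type_algebra :: 'a ring"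
  assume *: "0 \<in> I \<and> (\<forall>a\<in>I. \<forall>b\<in>I. a + b \<in> I) \<and> (\<forall>a\<in>I. \<forall>r. r * a \<in> I)"
  interpret cring ?R by (rule cring_from_type_algebra)
  have "additive_subgroup I ?R"
  proof (rule additive_subgroup.intro, rule group.subgroupI)
    show "group (add_monoid ?R)" by (rule a_group)
    fix a assume a: "a \<in> I"
    have "\<ominus>\<^bsub>?R\<^esub> a = - a"
      by (rule minus_equality) (auto simp: ring_of_type_algebra_def)
    moreover have "- a \<in> I" using * a by (metis mult_minus1)
    ultimately show "inv\<^bsub>add_monoid ?R\<^esub> a \<in> I" by (simp add: a_inv_def)
  qed (use * in \<open>auto simp: ring_of_type_algebra_def\<close>)
  moreover have "ideal_axioms I ?R"
    using * by (auto simp: ideal_axioms_def ring_of_type_algebra_def mult.commute)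
  ultimately show "ideal I ?R" by (simp add: ideal_def ring_axioms)
qed

lemma ideal_type_1_iff:
  assumes "ideal I (ring_of_type_algebra :: 'a::comm_ring_1 ring)"
  shows "1 \<in> I \<longleftrightarrow> I = UNIV"
  using assms by (auto simp: ideal_type_iff)

lemma primeideal_type_iff:
  "primeideal I (ring_of_type_algebra :: 'a::comm_ring_1 ring) \<longleftrightarrow>
     ideal I (ring_of_type_algebra :: 'a ring) \<and> 1 \<notin> I \<and> (\<forall>a b. a * b \<in> I \<longrightarrow> a \<in> I \<or> b \<in> I)"
  using ideal_type_1_iff[of I] cring_from_type_algebra[where 'a = 'a]
  unfolding primeideal_def primeideal_axioms_def
  by (auto simp: ring_of_type_algebra_def)

lemma
  assumes "ideal I (ring_of_type_algebra :: 'a::comm_ring_1 ring)"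
  shows ideal_type_0: "0 \<in> I"
    and ideal_type_add: "\<And>a b. a \<in> I \<Longrightarrow> b \<in> I \<Longrightarrow> a + b \<in> I"
    and ideal_type_mult: "\<And>a r. a \<in> I \<Longrightarrow> r * a \<in> I"
    and ideal_type_mult': "\<And>a r. a \<in> I \<Longrightarrow> a * r \<in> I"
    and ideal_type_diff: "\<And>a b. a \<in> I \<Longrightarrow> b \<in> I \<Longrightarrow> a - b \<in> I"
    and ideal_type_sum: "\<And>f A. (\<And>i::'b. i \<in> A \<Longrightarrow> f i \<in> I) \<Longrightarrow> sum f A \<in> I"
proof -
  show 0: "0 \<in> I" and add: "\<And>a b. a \<in> I \<Longrightarrow> b \<in> I \<Longrightarrow> a + b \<in> I"
    and mult: "\<And>a r. a \<in> I \<Longrightarrow> r * a \<in> I"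
    using assms by (auto simp: ideal_type_iff)
  show "\<And>a r. a \<in> I \<Longrightarrow> a * r \<in> I"
    using mult by (simp add: mult.commute)
  show "\<And>a b. a \<in> I \<Longrightarrow> b \<in> I \<Longrightarrow> a - b \<in> I"
    using add mult by (metis diff_conv_add_uminus mult_minus1)
  show "sum f A \<in> I" if "\<And>i. i \<in> A \<Longrightarrow> f i \<in> I" for f and A :: "'b set"
    using that by (induction A rule: infinite_finite_induct) (auto intro: 0 add)
qed

lemma
  assumes "primeideal P (ring_of_type_algebra :: 'a::comm_ring_1 ring)"
  shows prime_type_ideal: "ideal P (ring_of_type_algebra :: 'a ring)"
    and prime_type_1: "1 \<notin> P"
    and prime_type_mult: "\<And>a b. a * b \<in> P \<longleftrightarrow> a \<in> P \<or> b \<in> P"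
    and prime_type_power: "\<And>a k. a ^ k \<in> P \<Longrightarrow> a \<in> P"
    and prime_type_prod: "\<And>f A. prod f A \<in> P \<Longrightarrow> \<exists>i::'b\<in>A. f i \<in> P"
proof -
  show ideal: "ideal P (ring_of_type_algebra :: 'a ring)" and 1: "1 \<notin> P"
    using assms by (auto simp: primeideal_type_iff)
  show mult: "\<And>a b. a * b \<in> P \<longleftrightarrow> a \<in> P \<or> b \<in> P"
    using assms ideal_type_mult[OF ideal] ideal_type_mult'[OF ideal]
    by (auto simp: primeideal_type_iff)
  show "a ^ k \<in> P \<Longrightarrow> a \<in> P" for a k
    by (induction k) (auto simp: 1 mult)
  show "prod f A \<in> P \<Longrightarrow> \<exists>i\<in>A. f i \<in> P" for f and A :: "'b set"
    by (induction A rule: infinite_finite_induct) (auto simp: 1 mult)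
qed

lemma ideal_set_add:
  assumes "ideal I (ring_of_type_algebra :: 'a::comm_ring_1 ring)"
    and "ideal J (ring_of_type_algebra :: 'a ring)"
  shows "ideal (I <+>\<^bsub>ring_of_type_algebra\<^esub> J) (ring_of_type_algebra :: 'a ring)"
  using ring.add_ideals[OF ring_from_type_algebra assms] .

lemma set_add_type_iff:
  "x \<in> I <+>\<^bsub>(ring_of_type_algebra :: 'a::comm_ring_1 ring)\<^esub> J \<longleftrightarrow> (\<exists>a\<in>I. \<exists>b\<in>J. x = a + b)"
  by (auto simp: set_add_def set_mult_def ring_of_type_algebra_def)

lemma in_set_add_left:
  assumes "ideal J (ring_of_type_algebra :: 'a::comm_ring_1 ring)"
  shows "I \<subseteq> I <+>\<^bsub>ring_of_type_algebra\<^esub> J"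
  using ideal_type_0[OF assms] by (force simp: set_add_type_iff)

lemma in_set_add_right:
  assumes "ideal I (ring_of_type_algebra :: 'a::comm_ring_1 ring)"
  shows "J \<subseteq> I <+>\<^bsub>ring_of_type_algebra\<^esub> J"
  using ideal_type_0[OF assms] by (force simp: set_add_type_iff)

lemma set_add_subset_ideal:
  assumes "ideal P (ring_of_type_algebra :: 'a::comm_ring_1 ring)" "I \<subseteq> P" "J \<subseteq> P"
  shows "I <+>\<^bsub>ring_of_type_algebra\<^esub> J \<subseteq> P"
  using ideal_type_add[OF assms(1)] assms(2,3) by (fastforce simp: set_add_type_iff)

lemma
  fixes G :: "'a::comm_ring_1 set"
  shows ideal_genideal_type: "ideal (Idl\<^bsub>ring_of_type_algebra\<^esub> G) (ring_of_type_algebra :: 'a ring)"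
    and genideal_type_superset: "G \<subseteq> Idl\<^bsub>ring_of_type_algebra\<^esub> G"
    and genideal_type_least: "\<And>J. ideal J (ring_of_type_algebra :: 'a ring) \<Longrightarrow> G \<subseteq> J
          \<Longrightarrow> Idl\<^bsub>ring_of_type_algebra\<^esub> G \<subseteq> J"
  using ring.genideal_ideal[OF ring_from_type_algebra, of G] ring.genideal_self[OF ring_from_type_algebra, of G]
    ring.genideal_minimal[OF ring_from_type_algebra, of _ G]
  by (simp_all add: ring_of_type_algebra_def)

section \<open>Existence of primes, minimal primes and radical ideals\<close>

text \<open>Krull's argument: by Zorn there is an ideal maximal among those that contain
  \<open>I\<close> and miss all powers of \<open>f\<close>, and maximality forces it to be
  prime.\<close>

lemma prime_avoiding_powers:
  fixes f :: "'a::comm_ring_1"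
  assumes I: "ideal I (ring_of_type_algebra :: 'a ring)" and f: "\<And>k. f ^ k \<notin> I"
  obtains P where "primeideal P (ring_of_type_algebra :: 'a ring)" "I \<subseteq> P" "f \<notin> P"
proof -
  define A where "A = {J. ideal J (ring_of_type_algebra :: 'a ring) \<and> I \<subseteq> J \<and> (\<forall>k. f ^ k \<notin> J)}"
  have "\<exists>M\<in>A. \<forall>B\<in>A. M \<subseteq> B \<longrightarrow> B = M"
  proof (rule subset_Zorn_nonempty)
    show "A \<noteq> {}" using I f by (auto simp: A_def)
    fix C assume C: "C \<noteq> {}" "subset.chain A C"
    have CA: "C \<subseteq> A" using C by (auto simp: subset_chain_def)
    have "ideal (\<Union>C) (ring_of_type_algebra :: 'a ring)"
      unfolding ideal_type_iff
    proof (intro conjI ballI allI)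
      show "0 \<in> \<Union>C" using C CA ideal_type_0 by (auto simp: A_def)
      fix a assume a: "a \<in> \<Union>C"
      then show "r * a \<in> \<Union>C" for r using CA ideal_type_mult by (fastforce simp: A_def)
      fix b assume "b \<in> \<Union>C"
      with a obtain B Y where XY: "B \<in> C" "Y \<in> C" "a \<in> B" "b \<in> Y" by blast
      then have "B \<subseteq> Y \<or> Y \<subseteq> B" using C by (auto simp: subset_chain_def)
      then obtain Z where "Z \<in> C" "a \<in> Z" "b \<in> Z" using XY by blast
      moreover have "ideal Z (ring_of_type_algebra :: 'a ring)"
        using CA \<open>Z \<in> C\<close> by (auto simp: A_def)
      ultimately show "a + b \<in> \<Union>C" using ideal_type_add by blast
    qed
    then show "\<Union>C \<in> A" using C CA by (auto simp: A_def)
  qed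
  then obtain M where MA: "M \<in> A" and max: "\<And>B. B \<in> A \<Longrightarrow> M \<subseteq> B \<Longrightarrow> B = M" by blast
  then have M: "ideal M (ring_of_type_algebra :: 'a ring)" "I \<subseteq> M" "\<And>k. f ^ k \<notin> M"
    by (auto simp: A_def)
  \<comment> \<open>For \<open>a\<close> outside \<open>M\<close> the ideal \<open>M + (a)\<close>
    is strictly larger than \<open>M\<close>, so by maximality it contains a power of
    \<open>f\<close>.\<close>
  have key: "\<exists>k. \<exists>m\<in>M. \<exists>r. f ^ k = m + r * a" if "a \<notin> M" for a
  proof (rule ccontr)
    assume no: "\<not> ?thesis"
    let ?B = "{x. \<exists>m\<in>M. \<exists>r. x = m + r * a}"
    have "ideal ?B (ring_of_type_algebra :: 'a ring)"
      unfolding ideal_type_iff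
    proof (intro conjI ballI allI)
      show "0 \<in> ?B" using ideal_type_0[OF M(1)] by (auto intro!: bexI[of _ 0] exI[of _ 0])
      fix x assume "x \<in> ?B"
      then obtain m r where x: "m \<in> M" "x = m + r * a" by blast
      show "s * x \<in> ?B" for s
        using ideal_type_mult[OF M(1) x(1)] x(2)
        by (auto intro!: bexI[of _ "s * m"] exI[of _ "s * r"] simp: algebra_simps)
      fix y assume "y \<in> ?B"
      then obtain m' r' where y: "m' \<in> M" "y = m' + r' * a" by blast
      show "x + y \<in> ?B"
        using ideal_type_add[OF M(1) x(1) y(1)] x(2) y(2)
        by (auto intro!: bexI[of _ "m + m'"] exI[of _ "r + r'"] simp: algebra_simps)
    qed
    moreover have sub: "M \<subseteq> ?B" by (auto intro!: bexI exI[of _ 0])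
    ultimately have "?B \<in> A" using no M(2) by (auto simp: A_def)
    then have "?B = M" using max sub by blast
    moreover have "a \<in> ?B" using ideal_type_0[OF M(1)] by (auto intro!: bexI[of _ 0] exI[of _ 1])
    ultimately show False using that by blast
  qed
  have "primeideal M (ring_of_type_algebra :: 'a ring)"
    unfolding primeideal_type_iff
  proof (intro conjI allI impI M(1))
    show "1 \<notin> M" using M(3)[of 0] by simp
    fix a b assume ab: "a * b \<in> M"
    show "a \<in> M \<or> b \<in> M"
    proof (rule ccontr)
      assume "\<not> ?thesis"
      then obtain k m r l m' r' where *: "m \<in> M" "m' \<in> M" "f ^ k = m + r * a" "f ^ l = m' + r' * b"
        using key by metis
      \<comment> \<open>Multiplying the two expressions, every summand has a factor
        \<open>m\<close>, \<open>m'\<close> or \<open>a * b\<close>, all of which lie in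
        \<open>M\<close>.\<close>
      have "f ^ (k + l) = (m' + r' * b) * m + (r * a) * m' + (r * r') * (a * b)"
        by (simp add: power_add * algebra_simps)
      then have "f ^ (k + l) \<in> M"
        using * ab by (auto intro!: ideal_type_add[OF M(1)] ideal_type_mult[OF M(1)])
      then show False using M(3) by blast
    qed
  qed
  moreover have "f \<notin> M" using M(3)[of 1] by simp
  ultimately show ?thesis using M(2) that by blast
qed

text \<open>Zorn applied to complements, which reverse inclusion: a maximal complement is a minimal
  prime. The point to check is that the intersection of a chain of primes is prime.\<close>

lemma minimal_prime_below:
  fixes I :: "('n::finite, 'k::field) mpoly set"
  assumes "primeideal P (mpoly_ring :: ('n, 'k) mpoly ring)" "I \<subseteq> P"
  obtains q where "q \<in> minimal_primes I" "q \<subseteq> P"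
proof -
  define A where "A = {- Q | Q. primeideal Q (mpoly_ring :: ('n, 'k) mpoly ring) \<and> I \<subseteq> Q \<and> Q \<subseteq> P}"
  have "\<exists>M\<in>A. \<forall>B\<in>A. M \<subseteq> B \<longrightarrow> B = M"
  proof (rule subset_Zorn_nonempty)
    show "A \<noteq> {}" using assms by (auto simp: A_def)
    fix C assume C: "C \<noteq> {}" "subset.chain A C"
    have CA: "C \<subseteq> A" using C by (auto simp: subset_chain_def)
    have prime: "primeideal (- B) (mpoly_ring :: ('n, 'k) mpoly ring)" "I \<subseteq> - B" "- B \<subseteq> P"
      if "B \<in> C" for B
      using CA that by (auto simp: A_def)
    have "primeideal (- \<Union>C) (mpoly_ring :: ('n, 'k) mpoly ring)"
      unfolding primeideal_type_iff ideal_type_iff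
    proof (intro conjI ballI allI impI)
      show "0 \<in> - \<Union>C" using ideal_type_0[OF prime_type_ideal[OF prime(1)]] by auto
      show "1 \<notin> - \<Union>C" using prime_type_1[OF prime(1)] C(1) by fastforce
      show "a + b \<in> - \<Union>C" if "a \<in> - \<Union>C" "b \<in> - \<Union>C" for a b
        using ideal_type_add[OF prime_type_ideal[OF prime(1)], of _ a b] that by auto
      show "r * a \<in> - \<Union>C" if "a \<in> - \<Union>C" for a r
        using ideal_type_mult[OF prime_type_ideal[OF prime(1)], of _ a r] that by auto
      fix a b assume ab: "a * b \<in> - \<Union>C"
      show "a \<in> - \<Union>C \<or> b \<in> - \<Union>C"
      proof (rule ccontr)
        assume "\<not> ?thesis"
        then obtain B Y where XY: "B \<in> C" "Y \<in> C" "a \<in> B" "b \<in> Y" by blast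
        then have "B \<subseteq> Y \<or> Y \<subseteq> B" using C by (auto simp: subset_chain_def)
        \<comment> \<open>By the chain condition the larger of the two complements misses neither
          factor, so its prime would contain \<open>a * b\<close> but neither \<open>a\<close> nor
          \<open>b\<close>.\<close>
        then obtain Z where "Z \<in> C" "a \<in> Z" "b \<in> Z" using XY by blast
        then show False using prime_type_mult[OF prime(1), of Z a b] ab by auto
      qed
    qed
    moreover have "I \<subseteq> - \<Union>C" "- \<Union>C \<subseteq> P" using prime C(1) by blast+
    ultimately show "\<Union>C \<in> A" by (auto simp: A_def intro!: exI[of _ "- \<Union>C"])
  qed
  then obtain Q where Q: "primeideal Q (mpoly_ring :: ('n, 'k) mpoly ring)" "I \<subseteq> Q" "Q \<subseteq> P"
    and max: "\<And>B. B \<in> A \<Longrightarrow> - Q \<subseteq> B \<Longrightarrow> B = - Q"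
    by (auto simp: A_def)
  have "q = Q" if "primeideal q (mpoly_ring :: ('n, 'k) mpoly ring)" "I \<subseteq> q" "q \<subseteq> Q" for q
  proof -
    have "- q \<in> A" using that Q(3) by (auto simp: A_def)
    then have "- q = - Q" using max that(3) by blast
    then show ?thesis by blast
  qed
  then have "Q \<in> minimal_primes I" using Q by (auto simp: minimal_primes_def)
  then show ?thesis using Q(3) that by blast
qed

lemma
  assumes "radical_ideal (I :: ('n::finite, 'k::field) mpoly set)"
  shows radical_ideal_ideal: "ideal I mpoly_ring"
    and radical_ideal_power: "\<And>f k. f ^ k \<in> I \<Longrightarrow> f \<in> I"
proof -
  show I: "ideal I mpoly_ring" using assms by (simp add: radical_ideal_def)
  show "f \<in> I" if "f ^ k \<in> I" for f k
  \<comment> \<open>The definition speaks of positive exponents; for exponent 0 the assumption says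
    \<open>1\<close> is in \<open>I\<close>, so \<open>I\<close> is everything.\<close>
  proof (cases "k = 0")
    case True
    then show ?thesis using that ideal_type_mult[OF I, of 1 f] by simp
  next
    case False
    then show ?thesis using assms that unfolding radical_ideal_def by blast
  qed
qed

text \<open>If \<open>f\<close> is outside \<open>I\<close>, so are all its powers; some prime over
  \<open>I\<close> then avoids \<open>f\<close>, and so does any minimal prime below it.\<close>

lemma in_radical_ideal_if_in_minimal_primes:
  assumes "radical_ideal I" "\<And>q. q \<in> minimal_primes I \<Longrightarrow> f \<in> q"
  shows "f \<in> I"
proof (rule ccontr)
  assume "f \<notin> I"
  then have "\<And>k. f ^ k \<notin> I" using radical_ideal_power[OF assms(1)] by blast
  then obtain P where "primeideal P mpoly_ring" "I \<subseteq> P" "f \<notin> P"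
    using prime_avoiding_powers[OF radical_ideal_ideal[OF assms(1)]] by blast
  then show False using assms(2) minimal_prime_below by blast
qed

section \<open>Monomials and monomial ideals\<close>

lemma
  shows xmon_add: "xmon (u + v) = xmon u * xmon v"
    and xmon_sum: "xmon (sum g A) = (\<Prod>i\<in>A. xmon (g i))"
    and xmon_single: "xmon (Poly_Mapping.single i k) = Var i ^ k"
proof -
  have 0: "xmon 0 = 1" by (simp add: xmon_def)
  show add: "xmon (u + v) = xmon u * xmon v" for u v by (simp add: xmon_def mult_single)
  show "xmon (sum g A) = (\<Prod>i\<in>A. xmon (g i))"
    by (induction A rule: infinite_finite_induct) (simp_all add: 0 add)
  show "xmon (Poly_Mapping.single i k) = Var i ^ k"
  proof (induction k)
    case (Suc k)
    have "Poly_Mapping.single i (Suc k) = Poly_Mapping.single i 1 + Poly_Mapping.single i k"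
      by (simp flip: single_add)
    then show ?case using Suc by (simp add: add Var_def)
  qed (simp add: 0)
qed

lemma poly_mapping_sum_single:
  "f = (\<Sum>u\<in>Poly_Mapping.keys f. Poly_Mapping.single u (Poly_Mapping.lookup f u))"
  by (rule poly_mapping_eqI) (simp add: lookup_sum lookup_single when_def in_keys_iff)

lemma xmon_eq_prod: "xmon u = (\<Prod>i\<in>Poly_Mapping.keys u. Var i ^ Poly_Mapping.lookup u i)"
  by (subst poly_mapping_sum_single) (simp add: xmon_sum xmon_single)

lemma xmon_in_prime:
  assumes "primeideal P mpoly_ring" "xmon u \<in> P"
  obtains i where "i \<in> Poly_Mapping.keys u" "Var i \<in> P"
proof -
  obtain i where "i \<in> Poly_Mapping.keys u" "Var i ^ Poly_Mapping.lookup u i \<in> P"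
    using prime_type_prod[OF assms(1)] assms(2) unfolding xmon_eq_prod by blast
  then show ?thesis using prime_type_power[OF assms(1)] that by blast
qed

lemma xmon_in_ideal_if_Var:
  assumes "ideal J mpoly_ring" "Var i \<in> J" "i \<in> Poly_Mapping.keys u"
  shows "xmon u \<in> J"
proof -
  \<comment> \<open>The truncated subtraction is exact because \<open>i\<close> occurs in
    \<open>u\<close>.\<close>
  have "u = (u - Poly_Mapping.single i 1) + Poly_Mapping.single i 1"
    using assms(3) by (intro poly_mapping_eqI) (auto simp: lookup_add lookup_minus lookup_single when_def in_keys_iff)
  then have "xmon u = (xmon (u - Poly_Mapping.single i 1) * Var i :: ('a, 'b) mpoly)"
    by (metis Var_def xmon_add)
  then show ?thesis using ideal_type_mult[OF assms(1,2)] by simp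
qed

lemma single_conv_xmon: "Poly_Mapping.single u c = Poly_Mapping.single 0 c * xmon u"
  by (simp add: xmon_def mult_single)

lemma single_in_ideal:
  assumes "ideal J mpoly_ring" "xmon u \<in> J"
  shows "Poly_Mapping.single u c \<in> J"
  using ideal_type_mult[OF assms] by (subst single_conv_xmon)

lemma single_in_ideal_iff:
  assumes "ideal J mpoly_ring" "c \<noteq> 0"
  shows "Poly_Mapping.single u c \<in> J \<longleftrightarrow> xmon u \<in> J"
proof
  assume "Poly_Mapping.single u c \<in> J"
  then have "Poly_Mapping.single 0 (1 / c) * Poly_Mapping.single u c \<in> J"
    by (rule ideal_type_mult[OF assms(1)])
  then show "xmon u \<in> J" using assms(2) by (simp add: mult_single xmon_def)
qed (rule single_in_ideal[OF assms(1)])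

lemma in_ideal_if_monomials:
  assumes "ideal J mpoly_ring" "\<And>u. u \<in> Poly_Mapping.keys f \<Longrightarrow> xmon u \<in> J"
  shows "f \<in> J"
  by (subst poly_mapping_sum_single) (auto intro: ideal_type_sum single_in_ideal assms)

section \<open>Projections onto sets of exponents, and monomial ideals\<close>

text \<open>The linear projection onto the span of the monomials with exponent in \<open>C\<close>.
  Homogeneous components are one instance, components along the classes of \<open>mono_equiv\<close>
  another.\<close>

definition restrict_keys :: "'a set \<Rightarrow> ('a \<Rightarrow>\<^sub>0 'b::comm_monoid_add) \<Rightarrow> ('a \<Rightarrow>\<^sub>0 'b)" where
  "restrict_keys C f = (\<Sum>u\<in>{u \<in> Poly_Mapping.keys f. u \<in> C}. Poly_Mapping.single u (Poly_Mapping.lookup f u))"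

lemma lookup_restrict_keys: "Poly_Mapping.lookup (restrict_keys C f) u = (Poly_Mapping.lookup f u when u \<in> C)"
  by (simp add: restrict_keys_def lookup_sum lookup_single when_def in_keys_iff)

lemma keys_restrict_keys: "Poly_Mapping.keys (restrict_keys C f) = Poly_Mapping.keys f \<inter> C"
  by (auto simp: in_keys_iff lookup_restrict_keys when_def split: if_splits)

lemma restrict_keys_add: "restrict_keys C (f + g) = restrict_keys C f + restrict_keys C g"
  by (rule poly_mapping_eqI) (simp add: lookup_restrict_keys lookup_add when_def)

lemma restrict_keys_sum: "restrict_keys C (sum g A) = (\<Sum>i\<in>A. restrict_keys C (g i))"
  by (rule poly_mapping_eqI) (simp add: lookup_restrict_keys lookup_sum when_def)

lemma hom_component_eq_restrict_keys: "hom_component d f = restrict_keys {u. mdeg u = d} f"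
  by (simp add: hom_component_def restrict_keys_def)

lemma restrict_keys_eq_self: "Poly_Mapping.keys f \<subseteq> C \<Longrightarrow> restrict_keys C f = f"
  by (rule poly_mapping_eqI) (auto simp: lookup_restrict_keys when_def in_keys_iff)

lemma restrict_keys_eq_0: "Poly_Mapping.keys f \<inter> C = {} \<Longrightarrow> restrict_keys C f = 0"
  by (rule poly_mapping_eqI) (auto simp: lookup_restrict_keys when_def in_keys_iff)

text \<open>A monomial ideal is coded by its set of exponents; the result is an ideal once
  \<open>up_closed U\<close> holds.\<close>

definition mon_ideal :: "('n::finite \<Rightarrow>\<^sub>0 nat) set \<Rightarrow> ('n, 'k::field) mpoly set" where
  "mon_ideal U = {f. Poly_Mapping.keys f \<subseteq> U}"

definition up_closed :: "('n \<Rightarrow>\<^sub>0 nat) set \<Rightarrow> bool" where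
  "up_closed U \<longleftrightarrow> (\<forall>u\<in>U. \<forall>v. v + u \<in> U)"

lemma ideal_mon_ideal:
  assumes "up_closed U"
  shows "ideal (mon_ideal U) mpoly_ring"
  unfolding ideal_type_iff mon_ideal_def
proof (intro conjI ballI allI CollectI)
  fix a b :: "('a, 'b) mpoly" assume "a \<in> {f. Poly_Mapping.keys f \<subseteq> U}" "b \<in> {f. Poly_Mapping.keys f \<subseteq> U}"
  then show "Poly_Mapping.keys (a + b) \<subseteq> U" using Poly_Mapping.keys_add[of a b] by auto
next
  fix a r :: "('a, 'b) mpoly" assume "a \<in> {f. Poly_Mapping.keys f \<subseteq> U}"
  then show "Poly_Mapping.keys (r * a) \<subseteq> U"
    using keys_mult[of r a] assms by (fastforce simp: up_closed_def)
qed auto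

lemma xmon_in_mon_ideal: "xmon u \<in> (mon_ideal U :: ('n::finite, 'k::field) mpoly set) \<longleftrightarrow> u \<in> U"
  by (auto simp: mon_ideal_def xmon_def)

lemma mon_ideal_subset_ideal:
  assumes "ideal J (mpoly_ring :: ('n::finite, 'k::field) mpoly ring)" "\<And>u. u \<in> U \<Longrightarrow> xmon u \<in> J"
  shows "mon_ideal U \<subseteq> J"
  using in_ideal_if_monomials[OF assms(1)] assms(2) by (auto simp: mon_ideal_def)

lemma up_closed_ideal_exponents:
  assumes "\<And>J. J \<in> \<J> \<Longrightarrow> ideal J (mpoly_ring :: ('n::finite, 'k::field) mpoly ring)"
  shows "up_closed {u. xmon u \<in> \<Inter>\<J>}"
  using ideal_type_mult[OF assms] by (auto simp: up_closed_def xmon_add)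

section \<open>Radicals of sums of binomial and monomial ideals\<close>

text \<open>Any two monomials in \<open>I\<close> are related.\<close>

definition mono_equiv :: "('n::finite, 'k::field) mpoly set \<Rightarrow> ('n \<Rightarrow>\<^sub>0 nat) \<Rightarrow> ('n \<Rightarrow>\<^sub>0 nat) \<Rightarrow> bool" where
  "mono_equiv I u v \<longleftrightarrow> (\<exists>c. c \<noteq> 0 \<and> xmon u - Poly_Mapping.single v c \<in> I)"

lemma mono_equivI:
  assumes I: "ideal I mpoly_ring" and "a \<noteq> 0" "b \<noteq> 0"
    and ab: "Poly_Mapping.single u a + Poly_Mapping.single v b \<in> I"
  shows "mono_equiv I u v"
  unfolding mono_equiv_def
proof (intro exI conjI)
  show "- b / a \<noteq> 0" using assms by simp
  have "Poly_Mapping.single 0 (1 / a) * (Poly_Mapping.single u a + Poly_Mapping.single v b) \<in> I"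
    using ideal_type_mult[OF I ab] .
  then show "xmon u - Poly_Mapping.single v (- b / a) \<in> I"
    using assms by (simp add: distrib_left mult_single xmon_def single_uminus)
qed

lemma mono_equiv_sym:
  assumes I: "ideal I mpoly_ring" and "mono_equiv I u v"
  shows "mono_equiv I v u"
proof -
  obtain c where "c \<noteq> 0" "xmon u - Poly_Mapping.single v c \<in> I"
    using assms by (auto simp: mono_equiv_def)
  then show ?thesis
    by (intro mono_equivI[OF I, of "- c" 1]) (simp_all add: xmon_def single_uminus)
qed

lemma mono_equiv_trans:
  assumes I: "ideal I mpoly_ring" and "mono_equiv I u v" "mono_equiv I v w"
  shows "mono_equiv I u w"
proof -
  obtain c d where c: "c \<noteq> 0" "xmon u - Poly_Mapping.single v c \<in> I"
    and d: "d \<noteq> 0" "xmon v - Poly_Mapping.single w d \<in> I"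
    using assms by (auto simp: mono_equiv_def)
  have "xmon u - Poly_Mapping.single v c
      + Poly_Mapping.single 0 c * (xmon v - Poly_Mapping.single w d) \<in> I"
    using c d by (intro ideal_type_add[OF I] ideal_type_mult[OF I])
  then have "xmon u - Poly_Mapping.single w (c * d) \<in> I"
    by (simp add: xmon_def right_diff_distrib mult_single)
  then show ?thesis using c(1) d(1) unfolding mono_equiv_def by (intro exI[of _ "c * d"]) simp
qed

text \<open>If \<open>h\<close> has two terms, its membership in \<open>I\<close> makes their
  exponents equivalent, so a class contains all exponents of \<open>h\<close> or none; the
  projection is \<open>h\<close> or \<open>0\<close>.\<close>

lemma restrict_keys_equiv_class_two_terms:
  assumes I: "ideal I mpoly_ring" and h: "h \<in> I" "card (Poly_Mapping.keys h) \<le> 2"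
  shows "restrict_keys {v. mono_equiv I u v} h \<in> I"
proof -
  let ?C = "{v. mono_equiv I u v}"
  have "Poly_Mapping.keys h \<subseteq> ?C \<or> Poly_Mapping.keys h \<inter> ?C = {}"
  proof (cases "card (Poly_Mapping.keys h) = 2")
    case True
    then obtain a b where ab: "Poly_Mapping.keys h = {a, b}" "a \<noteq> b" by (auto simp: card_2_iff)
    then have "h = Poly_Mapping.single a (Poly_Mapping.lookup h a)
        + Poly_Mapping.single b (Poly_Mapping.lookup h b)"
      using poly_mapping_sum_single[of h] by simp
    moreover have "Poly_Mapping.lookup h a \<noteq> 0" "Poly_Mapping.lookup h b \<noteq> 0"
      using ab by (auto simp flip: in_keys_iff)
    ultimately have "mono_equiv I a b" using mono_equivI[OF I] h(1) by metis
    then have "mono_equiv I u a \<longleftrightarrow> mono_equiv I u b"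
      using mono_equiv_trans[OF I, of u a b] mono_equiv_trans[OF I, of u b a] mono_equiv_sym[OF I, of a b]
      by blast
    then show ?thesis using ab(1) by auto
  next
    case False
    then have "card (Poly_Mapping.keys h) \<le> Suc 0" using h(2) by simp
    then show ?thesis by (auto simp: card_le_Suc0_iff_eq)
  qed
  then show ?thesis
    using h(1) ideal_type_0[OF I] restrict_keys_eq_self[of h ?C] restrict_keys_eq_0[of h ?C] by auto
qed

lemma card_keys_single_mult_le:
  "card (Poly_Mapping.keys (Poly_Mapping.single w c * g)) \<le> card (Poly_Mapping.keys g)"
proof -
  have "Poly_Mapping.keys (Poly_Mapping.single w c * g) \<subseteq> (+) w ` Poly_Mapping.keys g"
    using keys_mult[of "Poly_Mapping.single w c" g] by (auto split: if_splits)
  then have "card (Poly_Mapping.keys (Poly_Mapping.single w c * g)) \<le> card ((+) w ` Poly_Mapping.keys g)"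
    by (intro card_mono) auto
  also have "\<dots> \<le> card (Poly_Mapping.keys g)" by (rule card_image_le) simp
  finally show ?thesis .
qed

text \<open>A binomial ideal is homogeneous for the decomposition by \<open>mono_equiv\<close>
  classes: it is spanned by term multiples of its generators, each with at most two terms.\<close>

lemma restrict_keys_equiv_class_in_binomial_ideal:
  fixes I :: "('n::finite, 'k::field) mpoly set"
  assumes "binomial_ideal I" "h \<in> I"
  shows "restrict_keys {v. mono_equiv I u v} h \<in> I"
proof -
  let ?\<pi> = "restrict_keys {v. mono_equiv I u v}"
  obtain G where G: "\<And>g. g \<in> G \<Longrightarrow> card (Poly_Mapping.keys g) \<le> 2" "I = Idl\<^bsub>mpoly_ring\<^esub> G"
    using assms by (auto simp: binomial_ideal_def)
  have I: "ideal I mpoly_ring" unfolding G(2) by (rule ideal_genideal_type)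
  \<comment> \<open>The projection is not multiplicative, so all multiples \<open>r * h\<close> are
    quantified over; this makes \<open>?J\<close> an ideal, and only generators remain to be
    tested.\<close>
  let ?J = "{h. \<forall>r. ?\<pi> (r * h) \<in> I}"
  have "ideal ?J (mpoly_ring :: ('n, 'k) mpoly ring)"
    unfolding ideal_type_iff
  proof (intro conjI ballI allI CollectI)
    fix a r s assume "a \<in> ?J"
    then have "?\<pi> (s * r * a) \<in> I" by blast
    then show "?\<pi> (s * (r * a)) \<in> I" by (simp only: mult.assoc)
  qed (use ideal_type_0[OF I] ideal_type_add[OF I] in \<open>auto simp: restrict_keys_eq_0 distrib_left restrict_keys_add\<close>)
  moreover have "G \<subseteq> ?J"
  proof clarify
    fix g r assume g: "g \<in> G"
    have "?\<pi> (Poly_Mapping.single w c * g) \<in> I" for w c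
    proof (rule restrict_keys_equiv_class_two_terms[OF I])
      show "Poly_Mapping.single w c * g \<in> I"
        using g genideal_type_superset[of G] G(2) ideal_type_mult[OF I] by blast
      show "card (Poly_Mapping.keys (Poly_Mapping.single w c * g)) \<le> 2"
        using G(1)[OF g] card_keys_single_mult_le[of w c g] by simp
    qed
    \<comment> \<open>By additivity, it suffices to treat each term of \<open>r\<close>
      separately.\<close>
    then have "?\<pi> ((\<Sum>w\<in>Poly_Mapping.keys r. Poly_Mapping.single w (Poly_Mapping.lookup r w)) * g) \<in> I"
      by (simp add: sum_distrib_right restrict_keys_sum ideal_type_sum[OF I])
    then show "?\<pi> (r * g) \<in> I" by (simp only: poly_mapping_sum_single[symmetric])
  qed
  ultimately have "I \<subseteq> ?J" unfolding G(2) by (rule genideal_type_least)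
  then have "?\<pi> (1 * h) \<in> I" using assms(2) by blast
  then show ?thesis by simp
qed

section \<open>Reduced representatives modulo \<open>I\<close>\<close>

text \<open>Take a representative of \<open>f\<close> modulo \<open>I\<close> with the fewest terms
  among those supported on the exponents of \<open>f\<close>; two equivalent exponents could be
  merged into one.\<close>

lemma reduce_mod_ideal:
  fixes I :: "('n::finite, 'k::field) mpoly set"
  assumes I: "ideal I mpoly_ring"
  obtains g where "f - g \<in> I" "Poly_Mapping.keys g \<subseteq> Poly_Mapping.keys f"
    "\<And>u v. u \<in> Poly_Mapping.keys g \<Longrightarrow> v \<in> Poly_Mapping.keys g \<Longrightarrow> mono_equiv I u v \<Longrightarrow> u = v"
proof -
  let ?A = "\<lambda>g. f - g \<in> I \<and> Poly_Mapping.keys g \<subseteq> Poly_Mapping.keys f"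
  have "?A f" using ideal_type_0[OF I] by simp
  from ex_has_least_nat[of ?A, OF this, of "\<lambda>g. card (Poly_Mapping.keys g)"]
  obtain g where g: "?A g" and least: "\<And>h. ?A h \<Longrightarrow> card (Poly_Mapping.keys g) \<le> card (Poly_Mapping.keys h)"
    by blast
  have "u = v" if uv: "u \<in> Poly_Mapping.keys g" "v \<in> Poly_Mapping.keys g" "mono_equiv I u v" for u v
  proof (rule ccontr)
    assume neq: "u \<noteq> v"
    obtain c where c: "xmon u - Poly_Mapping.single v c \<in> I" using uv(3) by (auto simp: mono_equiv_def)
    \<comment> \<open>Subtracting \<open>?b\<close> removes the term at \<open>u\<close> and moves a
      multiple of its coefficient to \<open>v\<close>. As \<open>v\<close> is already an exponent of
      \<open>g\<close>, no new term arises.\<close>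
    let ?b = "Poly_Mapping.single 0 (Poly_Mapping.lookup g u) * (xmon u - Poly_Mapping.single v c)"
    have b: "?b = Poly_Mapping.single u (Poly_Mapping.lookup g u)
        - Poly_Mapping.single v (Poly_Mapping.lookup g u * c)"
      by (simp add: right_diff_distrib mult_single xmon_def)
    have "?b \<in> I" using c by (rule ideal_type_mult[OF I])
    then have "f - g + ?b \<in> I" using g ideal_type_add[OF I] by blast
    then have 1: "f - (g - ?b) \<in> I" by (simp add: algebra_simps)
    have 2: "Poly_Mapping.keys (g - ?b) \<subseteq> Poly_Mapping.keys g - {u}"
      unfolding b using uv neq
      by (auto simp: in_keys_iff lookup_minus lookup_single when_def split: if_splits)
    have "card (Poly_Mapping.keys (g - ?b)) < card (Poly_Mapping.keys g)"
      using 2 uv(1) by (intro psubset_card_mono) auto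
    moreover have "card (Poly_Mapping.keys g) \<le> card (Poly_Mapping.keys (g - ?b))"
      using 1 2 g by (intro least) blast
    ultimately show False by simp
  qed
  then show ?thesis using g that by blast
qed

text \<open>Projecting to the class of \<open>u\<close> isolates one term of the reduced
  \<open>g\<close>, while it preserves both \<open>I\<close> and the monomial ideal.\<close>

lemma reduced_terms_in_ideal_sum:
  fixes I :: "('n::finite, 'k::field) mpoly set"
  assumes bin: "binomial_ideal I" and I: "ideal I mpoly_ring" and U: "up_closed U"
    and red: "\<And>u v. u \<in> Poly_Mapping.keys g \<Longrightarrow> v \<in> Poly_Mapping.keys g \<Longrightarrow> mono_equiv I u v \<Longrightarrow> u = v"
    and g: "g \<in> I <+>\<^bsub>mpoly_ring\<^esub> mon_ideal U" and u: "u \<in> Poly_Mapping.keys g"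
  shows "xmon u \<in> I <+>\<^bsub>mpoly_ring\<^esub> mon_ideal U"
proof -
  let ?C = "{v. mono_equiv I u v}"
  obtain a m where am: "a \<in> I" "m \<in> mon_ideal U" "g = a + m"
    using g by (auto simp: set_add_type_iff)
  have "mono_equiv I u u"
    unfolding mono_equiv_def using ideal_type_0[OF I] by (intro exI[of _ 1]) (simp add: xmon_def)
  then have "restrict_keys ?C g = Poly_Mapping.single u (Poly_Mapping.lookup g u)"
    using red[OF u] by (intro poly_mapping_eqI) (auto simp: lookup_restrict_keys lookup_single when_def in_keys_iff)
  moreover have "restrict_keys ?C a \<in> I" using restrict_keys_equiv_class_in_binomial_ideal[OF bin am(1)] .
  moreover have "restrict_keys ?C m \<in> mon_ideal U" using am(2) by (auto simp: mon_ideal_def keys_restrict_keys)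
  ultimately have "Poly_Mapping.single u (Poly_Mapping.lookup g u) \<in> I <+>\<^bsub>mpoly_ring\<^esub> mon_ideal U"
    unfolding set_add_type_iff am(3) restrict_keys_add by metis
  moreover have "Poly_Mapping.lookup g u \<noteq> 0" using u by (simp add: in_keys_iff)
  ultimately show ?thesis
    using single_in_ideal_iff[OF ideal_set_add[OF I ideal_mon_ideal[OF U]]] by blast
qed

text \<open>The reduction depends on \<open>I\<close> alone, so a single \<open>g\<close> serves all
  \<open>U i\<close> at once. Thus an intersection of ideals \<open>I\<close> plus monomial is again
  of this shape.\<close>

lemma binomial_plus_monomial_INT:
  fixes I :: "('n::finite, 'k::field) mpoly set"
  assumes bin: "binomial_ideal I" and I: "ideal I mpoly_ring"
    and U: "\<And>i. i \<in> A \<Longrightarrow> up_closed (U i)"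
    and f: "\<And>i. i \<in> A \<Longrightarrow> f \<in> I <+>\<^bsub>mpoly_ring\<^esub> mon_ideal (U i)"
  obtains g where "f - g \<in> I"
    "\<And>u i. u \<in> Poly_Mapping.keys g \<Longrightarrow> i \<in> A \<Longrightarrow> xmon u \<in> I <+>\<^bsub>mpoly_ring\<^esub> mon_ideal (U i)"
proof -
  obtain g where g: "f - g \<in> I"
    "\<And>u v. u \<in> Poly_Mapping.keys g \<Longrightarrow> v \<in> Poly_Mapping.keys g \<Longrightarrow> mono_equiv I u v \<Longrightarrow> u = v"
    using reduce_mod_ideal[OF I, of f] by metis
  have "xmon u \<in> I <+>\<^bsub>mpoly_ring\<^esub> mon_ideal (U i)" if "u \<in> Poly_Mapping.keys g" "i \<in> A" for u i
  proof (rule reduced_terms_in_ideal_sum[OF bin I U g(2)])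
    have id: "ideal (I <+>\<^bsub>mpoly_ring\<^esub> mon_ideal (U i)) mpoly_ring"
      using ideal_set_add[OF I ideal_mon_ideal[OF U]] that by blast
    have "f - (f - g) \<in> I <+>\<^bsub>mpoly_ring\<^esub> mon_ideal (U i)"
      by (rule ideal_type_diff[OF id f[OF that(2)] subsetD[OF in_set_add_left g(1)]])
        (rule ideal_mon_ideal[OF U[OF that(2)]])
    then show "g \<in> I <+>\<^bsub>mpoly_ring\<^esub> mon_ideal (U i)" by simp
  qed (use that in auto)
  then show ?thesis using that g(1) by blast
qed

text \<open>Reduction creates no new exponents, so a surviving term of \<open>g\<close> would be a
  term of \<open>f\<close> whose monomial lies in the sum; hence \<open>g = 0\<close>.\<close>

lemma binomial_plus_monomial_no_terms:
  fixes I :: "('n::finite, 'k::field) mpoly set"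
  assumes bin: "binomial_ideal I" and I: "ideal I mpoly_ring" and U: "up_closed U"
    and f: "f \<in> I <+>\<^bsub>mpoly_ring\<^esub> mon_ideal U"
    and no: "\<And>u. u \<in> Poly_Mapping.keys f \<Longrightarrow> xmon u \<notin> I <+>\<^bsub>mpoly_ring\<^esub> mon_ideal U"
  shows "f \<in> I"
proof -
  let ?J = "I <+>\<^bsub>mpoly_ring\<^esub> mon_ideal U"
  obtain g where g: "f - g \<in> I" "Poly_Mapping.keys g \<subseteq> Poly_Mapping.keys f"
    "\<And>u v. u \<in> Poly_Mapping.keys g \<Longrightarrow> v \<in> Poly_Mapping.keys g \<Longrightarrow> mono_equiv I u v \<Longrightarrow> u = v"
    using reduce_mod_ideal[OF I, of f] by metis
  have "f - (f - g) \<in> ?J"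
    by (rule ideal_type_diff[OF _ f subsetD[OF in_set_add_left g(1)]])
      (intro ideal_set_add I ideal_mon_ideal U)+
  then have "xmon u \<in> ?J" if "u \<in> Poly_Mapping.keys g" for u
    using reduced_terms_in_ideal_sum[OF bin I U g(3)] that by auto
  then have "Poly_Mapping.keys g = {}" using no g(2) by blast
  then show ?thesis using g(1) by simp
qed

section \<open>Monomials in the radical of \<open>I\<close> plus a monomial ideal\<close>

text \<open>The exponents of the monomials in the radical of \<open>J\<close>, with the radical
  taken as an intersection of primes so that membership is tested prime by prime.\<close>

definition rad_exponents :: "('n::finite, 'k::field) mpoly set \<Rightarrow> ('n \<Rightarrow>\<^sub>0 nat) set" where
  "rad_exponents J = {u. xmon u \<in> \<Inter>{P. primeideal P mpoly_ring \<and> J \<subseteq> P}}"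

lemma up_closed_rad_exponents: "up_closed (rad_exponents J)"
  unfolding rad_exponents_def by (rule up_closed_ideal_exponents) (auto intro: prime_type_ideal)

lemma up_closed_Un:
  "up_closed U \<Longrightarrow> up_closed V \<Longrightarrow> up_closed (U \<union> V)"
  by (auto simp: up_closed_def)

lemma polys_in_mult:
  assumes "f \<in> polys_in T" "g \<in> polys_in T"
  shows "f * g \<in> polys_in T"
  unfolding polys_in_def
proof (intro CollectI ballI)
  fix w assume "w \<in> Poly_Mapping.keys (f * g)"
  then obtain u v where "w = u + v" "u \<in> Poly_Mapping.keys f" "v \<in> Poly_Mapping.keys g"
    using keys_mult[of f g] by blast
  then show "Poly_Mapping.keys w \<subseteq> T"
    using assms Poly_Mapping.keys_add[of u v] by (fastforce simp: polys_in_def)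
qed

lemma polys_in_power: "f \<in> polys_in T \<Longrightarrow> f ^ k \<in> polys_in T"
  by (induction k) (auto simp: polys_in_mult, auto simp: polys_in_def)

text \<open>
  The radical of \<open>I + N\<close> is the intersection of the radicals of \<open>I + N + (x\<^sub>i)\<close> over the
  variables of any monomial in \<open>I + N\<close>; modulo \<open>x\<^sub>i\<close> one variable is lost.
\<close>

lemma radical_binomial_plus_monomial_aux:
  fixes I :: "('n::finite, 'k::field) mpoly set"
  assumes bin: "binomial_ideal I" and rad: "radical_ideal I" and "up_closed U"
    and "f \<in> polys_in T"
    and "\<And>P. primeideal P mpoly_ring \<Longrightarrow> I <+>\<^bsub>mpoly_ring\<^esub> mon_ideal U \<subseteq> P \<Longrightarrow> f \<in> P"
  shows "f \<in> I <+>\<^bsub>mpoly_ring\<^esub> mon_ideal (rad_exponents (I <+>\<^bsub>mpoly_ring\<^esub> mon_ideal U))"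
  using finite[of T] assms(3-)
proof (induction T arbitrary: U f rule: finite_psubset_induct)
  case (psubset T)
  note U = psubset.prems(1)
  let ?J = "\<lambda>U. I <+>\<^bsub>mpoly_ring\<^esub> mon_ideal U"
  let ?R = "\<lambda>U. rad_exponents (?J U)"
  note I = radical_ideal_ideal[OF rad]
  have J: "ideal (?J U) mpoly_ring" if "up_closed U" for U
    using ideal_set_add[OF I ideal_mon_ideal[OF that]] .
  show ?case
  proof (cases "\<exists>w. Poly_Mapping.keys w \<subseteq> T \<and> xmon w \<in> ?J U")
    \<comment> \<open>With no monomial in the variables \<open>T\<close> available, a power of
      \<open>f\<close> in the sum has no term there, so it lies in \<open>I\<close>; as
      \<open>I\<close> is radical, so does \<open>f\<close>.\<close>
    case False
    have "\<exists>k. f ^ k \<in> ?J U"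
      using prime_avoiding_powers[OF J[OF U]] psubset.prems(3) by metis
    then obtain k where k: "f ^ k \<in> ?J U" by blast
    have "f ^ k \<in> I"
    proof (rule binomial_plus_monomial_no_terms[OF bin I U k])
      show "xmon u \<notin> ?J U" if "u \<in> Poly_Mapping.keys (f ^ k)" for u
        using polys_in_power[OF psubset.prems(2), of k] False that by (auto simp: polys_in_def)
    qed
    then have "f \<in> I" by (rule radical_ideal_power[OF rad])
    then show ?thesis
      using in_set_add_left[OF ideal_mon_ideal[OF up_closed_rad_exponents]] by blast
  next
    case True
    then obtain w where w: "Poly_Mapping.keys w \<subseteq> T" "xmon w \<in> ?J U" by blast
    \<comment> \<open>\<open>V i\<close> is the exponent set of the monomial ideal of
      \<open>U\<close> enlarged by the variable \<open>i\<close>.\<close>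
    define V where "V = (\<lambda>i. U \<union> {u. i \<in> Poly_Mapping.keys u})"
    have V: "up_closed (V i)" for i
      unfolding V_def using U
      by (intro up_closed_Un) (auto simp: up_closed_def in_keys_iff lookup_add)
    have f: "f \<in> ?J (?R (V i))" if i: "i \<in> Poly_Mapping.keys w" for i
    proof -
      \<comment> \<open>The terms free of variable \<open>i\<close> fall under the induction
        hypothesis for \<open>T - {i}\<close>; the others lie in \<open>mon_ideal (V i)\<close>
        already.\<close>
      let ?f = "restrict_keys {u. i \<notin> Poly_Mapping.keys u} f"
      let ?d = "restrict_keys {u. i \<in> Poly_Mapping.keys u} f"
      have split: "f = ?f + ?d"
        by (rule poly_mapping_eqI) (auto simp: lookup_add lookup_restrict_keys when_def)
      have d: "?d \<in> mon_ideal (V i)" by (auto simp: mon_ideal_def keys_restrict_keys V_def)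
      have "?f \<in> ?J (?R (V i))"
      proof (rule psubset.IH[OF _ V])
        show "T - {i} \<subset> T" using i w(1) by auto
        show "?f \<in> polys_in (T - {i})"
          using psubset.prems(2) by (auto simp: polys_in_def keys_restrict_keys)
        fix P assume P: "primeideal P mpoly_ring" "?J (V i) \<subseteq> P"
        have "mon_ideal U \<subseteq> mon_ideal (V i)" by (auto simp: mon_ideal_def V_def)
        then have "?J U \<subseteq> ?J (V i)"
          unfolding subset_iff set_add_type_iff by blast
        then have "f \<in> P" using psubset.prems(3) P by blast
        moreover have "?d \<in> P" using d P(2) in_set_add_right[OF I] by blast
        ultimately have "f - ?d \<in> P" by (rule ideal_type_diff[OF prime_type_ideal[OF P(1)]])
        moreover have "f - ?d = ?f" by (subst (1) split) simp
        ultimately show "?f \<in> P" by simp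
      qed
      moreover have "?d \<in> ?J (?R (V i))"
      proof -
        have "V i \<subseteq> ?R (V i)"
          using in_set_add_right[OF I, of "mon_ideal (V i)"] xmon_in_mon_ideal
          by (auto simp: rad_exponents_def)
        then have "?d \<in> mon_ideal (?R (V i))" using d by (auto simp: mon_ideal_def)
        then show ?thesis using in_set_add_right[OF I] by blast
      qed
      ultimately show ?thesis
        using ideal_type_add[OF J[OF up_closed_rad_exponents]] split by metis
    qed
    obtain g where g: "f - g \<in> I"
      "\<And>u i. u \<in> Poly_Mapping.keys g \<Longrightarrow> i \<in> Poly_Mapping.keys w \<Longrightarrow> xmon u \<in> ?J (?R (V i))"
      using binomial_plus_monomial_INT[OF bin I,
          where A = "Poly_Mapping.keys w" and U = "\<lambda>i. ?R (V i)" and f = f, OF up_closed_rad_exponents f]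
      by blast
    \<comment> \<open>A prime over the sum contains \<open>xmon w\<close>, hence a variable
      \<open>i\<close> of \<open>w\<close>, hence all monomials in the radical for
      \<open>V i\<close>. If \<open>w = 0\<close>, there is no such prime.\<close>
    have "u \<in> ?R U" if u: "u \<in> Poly_Mapping.keys g" for u
      unfolding rad_exponents_def
    proof (intro CollectI InterI; clarify)
      fix P assume P: "primeideal P mpoly_ring" "?J U \<subseteq> P"
      note Pid = prime_type_ideal[OF P(1)]
      obtain i where i: "i \<in> Poly_Mapping.keys w" "Var i \<in> P"
        using xmon_in_prime[OF P(1)] w(2) P(2) by blast
      have IU: "I \<subseteq> P" "mon_ideal U \<subseteq> P"
        using P(2) in_set_add_left[OF ideal_mon_ideal[OF U]] in_set_add_right[OF I] by blast+
      have "mon_ideal (V i) \<subseteq> P"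
        using IU(2) xmon_in_mon_ideal xmon_in_ideal_if_Var[OF Pid i(2)]
        by (intro mon_ideal_subset_ideal[OF Pid]) (auto simp: V_def)
      then have "?J (V i) \<subseteq> P" using set_add_subset_ideal[OF Pid IU(1)] by blast
      then have "mon_ideal (?R (V i)) \<subseteq> P"
        using P(1) by (intro mon_ideal_subset_ideal[OF Pid]) (auto simp: rad_exponents_def)
      then show "xmon u \<in> P" using set_add_subset_ideal[OF Pid IU(1)] g(2)[OF u i(1)] by blast
    qed
    then have "g \<in> mon_ideal (?R U)" by (auto simp: mon_ideal_def)
    then show ?thesis using g(1) unfolding set_add_type_iff by (metis diff_add_cancel)
  qed
qed

lemma radical_binomial_plus_monomial:
  fixes I :: "('n::finite, 'k::field) mpoly set"
  assumes "binomial_ideal I" "radical_ideal I" "up_closed U"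
    and "\<And>P. primeideal P mpoly_ring \<Longrightarrow> I <+>\<^bsub>mpoly_ring\<^esub> mon_ideal U \<subseteq> P \<Longrightarrow> f \<in> P"
  shows "f \<in> I <+>\<^bsub>mpoly_ring\<^esub> mon_ideal (rad_exponents (I <+>\<^bsub>mpoly_ring\<^esub> mon_ideal U))"
  by (rule radical_binomial_plus_monomial_aux[OF assms(1-3), where T = UNIV])
     (use assms(4) in \<open>auto simp: polys_in_def\<close>)

section \<open>Coordinate-saturated ideals\<close>

lemma minimal_primesD:
  assumes "q \<in> minimal_primes I"
  shows "primeideal q mpoly_ring" "ideal q mpoly_ring" "I \<subseteq> q"
    "\<And>P. primeideal P mpoly_ring \<Longrightarrow> I \<subseteq> P \<Longrightarrow> P \<subseteq> q \<Longrightarrow> P = q"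
  using assms by (auto simp: minimal_primes_def prime_type_ideal)

lemma
  assumes I: "ideal I mpoly_ring"
  shows Var_in_add_vars: "i \<in> S \<Longrightarrow> Var i \<in> add_vars I S"
    and add_vars_empty: "add_vars I {} = I"
proof -
  show "i \<in> S \<Longrightarrow> Var i \<in> add_vars I S"
    unfolding add_vars_def
    using in_set_add_right[OF I] genideal_type_superset[of "Var ` S"] by blast
  have "add_vars I {} \<subseteq> I"
    unfolding add_vars_def by (simp add: set_add_subset_ideal[OF I] genideal_type_least[OF I])
  moreover have "I \<subseteq> add_vars I {}"
    unfolding add_vars_def by (rule in_set_add_left[OF ideal_genideal_type])
  ultimately show "add_vars I {} = I" by blast
qed

lemma add_vars_subset_P_ideal: "add_vars I S \<subseteq> P_ideal S I"
  by (auto simp: P_ideal_def saturation_def intro: exI[of _ 0])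

lemma Var_in_prime_P_ideal_iff:
  assumes I: "ideal I mpoly_ring" and prime: "primeideal (P_ideal S I) mpoly_ring"
  shows "Var i \<in> P_ideal S I \<longleftrightarrow> i \<in> S"
proof
  assume *: "Var i \<in> P_ideal S I"
  show "i \<in> S"
  proof (rule ccontr)
    assume "i \<notin> S"
    then have "(\<Prod>j\<in>-S. Var j) = Var i * (\<Prod>j\<in>-S - {i}. Var j)" by (simp add: prod.remove)
    then have "(\<Prod>j\<in>-S. Var j) \<in> P_ideal S I"
      using ideal_type_mult'[OF prime_type_ideal[OF prime] *] by metis
    then obtain k where "(\<Prod>j\<in>-S. Var j) * (\<Prod>j\<in>-S. Var j) ^ k \<in> add_vars I S"
      by (auto simp: P_ideal_def saturation_def)
    \<comment> \<open>Read as a power times \<open>1\<close>, this puts \<open>1\<close> into the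
      saturation.\<close>
    then have "1 * (\<Prod>j\<in>-S. Var j) ^ Suc k \<in> add_vars I S" by simp
    then have "1 \<in> P_ideal S I" unfolding P_ideal_def saturation_def by blast
    then show False using prime_type_1[OF prime] by blast
  qed
next
  assume "i \<in> S"
  then show "Var i \<in> P_ideal S I"
    using Var_in_add_vars[OF I] add_vars_subset_P_ideal by blast
qed

lemma coordinate_saturatedD:
  assumes "coordinate_saturated I"
  shows "radical_ideal I" "ideal I mpoly_ring"
    "\<And>q. q \<in> minimal_primes I \<Longrightarrow> \<exists>S. q = P_ideal S I"
    "\<And>S. P_ideal S I \<in> minimal_primes I \<Longrightarrow>
        add_vars I S \<inter> polys_in (-S) = I \<inter> polys_in (-S)"
  using assms radical_ideal_ideal by (auto simp: coordinate_saturated_def)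

lemma prod_in_polys_in: "(\<And>i. i \<in> A \<Longrightarrow> f i \<in> polys_in T) \<Longrightarrow> prod f A \<in> polys_in T"
proof (induction A rule: infinite_finite_induct)
  case (insert x A)
  then show ?case by (simp add: polys_in_mult)
qed (simp_all add: polys_in_def)

lemma Var_in_polys_in: "i \<in> T \<Longrightarrow> Var i \<in> polys_in T"
  by (auto simp: polys_in_def Var_def xmon_def)

text \<open>A power of the product of the variables outside \<open>S\<close> moves \<open>g\<close>
  into \<open>add_vars I S\<close> without leaving the subring, so the product lies in
  \<open>I\<close> by coordinate saturation. The prime \<open>p\<close> has no variables, so the
  power cancels.\<close>

lemma P_ideal_polys_in_subset:
  fixes I :: "('n::finite, 'k::field) mpoly set"
  assumes cs: "coordinate_saturated I" and q: "P_ideal S I \<in> minimal_primes I"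
    and p: "primeideal p mpoly_ring" "I \<subseteq> p" "\<And>i. Var i \<notin> p"
  shows "P_ideal S I \<inter> polys_in (-S) \<subseteq> p"
proof clarify
  fix g :: "('n, 'k) mpoly" assume g: "g \<in> P_ideal S I" "g \<in> polys_in (-S)"
  let ?x = "\<Prod>i\<in>-S. Var i :: ('n, 'k) mpoly"
  obtain k where k: "g * ?x ^ k \<in> add_vars I S" using g by (auto simp: P_ideal_def saturation_def)
  have "?x \<in> polys_in (-S)" by (intro prod_in_polys_in Var_in_polys_in)
  then have "g * ?x ^ k \<in> polys_in (-S)" by (intro polys_in_mult g(2) polys_in_power)
  then have "g * ?x ^ k \<in> p" using k coordinate_saturatedD(4)[OF cs q] p(2) by blast
  moreover have "?x ^ k \<notin> p"
    using p(3) prime_type_power[OF p(1), of ?x k] prime_type_prod[OF p(1), of Var "- S"] by blast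
  ultimately show "g \<in> p" using prime_type_mult[OF p(1)] by blast
qed

text \<open>Split \<open>g\<close> by whether a term involves a variable of \<open>S\<close>: the
  terms that do lie in any ideal containing these variables, and the remaining part lies in
  \<open>p\<close>.\<close>

lemma P_ideal_subset_prime:
  fixes I :: "('n::finite, 'k::field) mpoly set"
  assumes cs: "coordinate_saturated I" and q: "P_ideal S I \<in> minimal_primes I"
    and p: "primeideal p mpoly_ring" "I \<subseteq> p" "\<And>i. Var i \<notin> p"
    and P: "ideal P mpoly_ring" "p \<subseteq> P" "\<And>i. i \<in> S \<Longrightarrow> Var i \<in> P"
  shows "P_ideal S I \<subseteq> P"
proof
  fix g assume g: "g \<in> P_ideal S I"
  note qid = minimal_primesD(2)[OF q]
  let ?C = "{u. Poly_Mapping.keys u \<subseteq> - S}"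
  have split: "g = restrict_keys ?C g + restrict_keys (- ?C) g"
    by (rule poly_mapping_eqI) (auto simp: lookup_add lookup_restrict_keys when_def)
  \<comment> \<open>Stated for general \<open>J\<close> because it is used for
    \<open>P_ideal S I\<close>, to keep the other part of \<open>g\<close> there, and for
    \<open>P\<close>.\<close>
  have in_J: "restrict_keys (- ?C) g \<in> J" if "ideal J mpoly_ring" "\<And>i. i \<in> S \<Longrightarrow> Var i \<in> J" for J
  proof (rule in_ideal_if_monomials[OF that(1)])
    fix u assume "u \<in> Poly_Mapping.keys (restrict_keys (- ?C) g)"
    then obtain i where "i \<in> S" "i \<in> Poly_Mapping.keys u" by (auto simp: keys_restrict_keys)
    then show "xmon u \<in> J" using xmon_in_ideal_if_Var[OF that(1) that(2)] by blast
  qed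
  have "restrict_keys (- ?C) g \<in> P_ideal S I"
    by (rule in_J[OF qid])
      (simp add: Var_in_prime_P_ideal_iff[OF coordinate_saturatedD(2)[OF cs] minimal_primesD(1)[OF q]])
  then have "g - restrict_keys (- ?C) g \<in> P_ideal S I" by (rule ideal_type_diff[OF qid g])
  moreover have "g - restrict_keys (- ?C) g = restrict_keys ?C g"
    by (subst (1) split) simp
  moreover have "restrict_keys ?C g \<in> polys_in (-S)" by (auto simp: polys_in_def keys_restrict_keys)
  ultimately have "restrict_keys ?C g \<in> P" using P_ideal_polys_in_subset[OF cs q p] P(2) by auto
  then have "restrict_keys ?C g + restrict_keys (- ?C) g \<in> P" by (rule ideal_type_add[OF P(1) _ in_J[OF P(1,3)]])
  then show "g \<in> P" using split by simp
qed

section \<open>The monomial ideal \<open>M\<close> and the primes over \<open>I + M\<close>\<close>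

text \<open>The monomials of an intersection of ideals have an up-closed exponent set, so generating
  an ideal from them adds no monomials.\<close>

lemma M_ideal_eq_mon_ideal:
  "M_ideal p I = mon_ideal {u. xmon u \<in> \<Inter>(minimal_primes I - {p})}" (is "_ = mon_ideal ?U")
proof
  have "up_closed ?U" by (rule up_closed_ideal_exponents) (auto dest: minimal_primesD(2))
  then have "ideal (mon_ideal ?U) mpoly_ring" by (rule ideal_mon_ideal)
  moreover have "{xmon u | u. xmon u \<in> \<Inter>(minimal_primes I - {p})} \<subseteq> mon_ideal ?U"
    unfolding mon_ideal_def by (auto simp: xmon_def)
  ultimately show "M_ideal p I \<subseteq> mon_ideal ?U"
    unfolding M_ideal_def by (rule genideal_type_least)
  show "mon_ideal ?U \<subseteq> M_ideal p I"
    unfolding M_ideal_def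
    by (rule mon_ideal_subset_ideal[OF ideal_genideal_type], rule subsetD[OF genideal_type_superset]) blast
qed

lemma xmon_in_M_ideal_iff: "xmon u \<in> M_ideal p I \<longleftrightarrow> xmon u \<in> \<Inter>(minimal_primes I - {p})"
  by (simp add: M_ideal_eq_mon_ideal xmon_in_mon_ideal)

lemma prod_Var_eq_xmon: "(\<Prod>i\<in>A. Var i) = xmon (\<Sum>i\<in>A. Poly_Mapping.single i 1)"
  by (simp add: xmon_sum Var_def)

text \<open>
  A prime over \<open>I + M\<close> containing no minimal prime other than \<open>p\<close> still contains \<open>p\<close>. The product
  of the variables outside it is not in \<open>M\<close>, so it avoids some \<open>P\<^sub>S(I) \<noteq> p\<close>; this puts the
  variables in \<open>S\<close> into the prime, and \<open>P\<^sub>S(I) \<subseteq> p + (x\<^sub>i : i \<in> S)\<close>.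
\<close>

lemma other_minimal_primes_subset_prime:
  fixes I :: "('n::finite, 'k::field) mpoly set"
  assumes cs: "coordinate_saturated I" and p: "p \<in> minimal_primes I" "\<And>i. Var i \<notin> p"
    and P: "primeideal P mpoly_ring" "I \<subseteq> P" "M_ideal p I \<subseteq> P"
  shows "\<Inter>(minimal_primes I - {p}) \<subseteq> P"
proof -
  obtain q where q: "q \<in> minimal_primes I" "q \<subseteq> P" using minimal_prime_below P by blast
  show ?thesis
  proof (cases "q = p")
    case False
    then show ?thesis using q by blast
  next
    case True
    let ?x = "\<Prod>i\<in>{i. Var i \<notin> P}. Var i :: ('n, 'k) mpoly"
    have "?x \<notin> P" using prime_type_prod[OF P(1), of Var "{i. Var i \<notin> P}"] by blast
    then have "?x \<notin> M_ideal p I" using P(3) by blast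
    then obtain q' where q': "q' \<in> minimal_primes I" "q' \<noteq> p" "?x \<notin> q'"
      unfolding prod_Var_eq_xmon xmon_in_M_ideal_iff by blast
    then obtain S where S: "q' = P_ideal S I" using coordinate_saturatedD(3)[OF cs] by blast
    have "Var i \<in> P" if i: "i \<in> S" for i
    proof (rule ccontr)
      assume *: "Var i \<notin> P"
      have "Var i \<in> q'"
        using i Var_in_prime_P_ideal_iff[OF coordinate_saturatedD(2)[OF cs]] minimal_primesD(1)[OF q'(1)] S
        by blast
      then have "Var i * (\<Prod>j\<in>{j. Var j \<notin> P} - {i}. Var j) \<in> q'"
        by (rule ideal_type_mult'[OF minimal_primesD(2)[OF q'(1)]])
      then show False using q'(3) * by (simp add: prod.remove[of _ i])
    qed
    then have "q' \<subseteq> P"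
      using P_ideal_subset_prime[OF cs _ minimal_primesD(1,3)[OF p(1)] p(2) prime_type_ideal[OF P(1)]]
        q' S q True by blast
    then show ?thesis using q' by blast
  qed
qed

text \<open>Here \<open>S\<close> must be empty, so \<open>p\<close> is the saturation of
  \<open>I\<close> by the product of all variables; radicality lowers the saturation exponent to
  1.\<close>

lemma prime_eq_colon_prod_Var:
  fixes I :: "('n::finite, 'k::field) mpoly set"
  assumes cs: "coordinate_saturated I" and p: "p \<in> minimal_primes I" "\<And>i. Var i \<notin> p"
  shows "p = colon I (\<Prod>i\<in>UNIV. Var i)"
proof -
  note I = coordinate_saturatedD(2)[OF cs]
  let ?x = "\<Prod>i\<in>UNIV. Var i :: ('n, 'k) mpoly"
  obtain S where S: "p = P_ideal S I" using coordinate_saturatedD(3)[OF cs p(1)] by blast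
  then have "S = {}"
    using Var_in_prime_P_ideal_iff[OF I] minimal_primesD(1)[OF p(1)] p(2) by blast
  then have eq: "p = saturation I ?x" using S by (simp add: P_ideal_def add_vars_empty[OF I])
  have "g * ?x \<in> I" if "g * ?x ^ k \<in> I" for g k
  proof (rule radical_ideal_power[OF coordinate_saturatedD(1)[OF cs]])
    \<comment> \<open>The extra factor completes the element to the power \<open>Suc k\<close> of
      \<open>g * ?x\<close>.\<close>
    have "g ^ k * ?x * (g * ?x ^ k) \<in> I" using that by (rule ideal_type_mult[OF I])
    then show "(g * ?x) ^ Suc k \<in> I" by (simp add: power_mult_distrib algebra_simps)
  qed
  then show ?thesis
    unfolding eq by (auto simp: saturation_def colon_def intro: exI[of _ 1])
qed

section \<open>Comparison of the v-number with \<open>gamma\<close>\<close>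

text \<open>The monomial avoids \<open>p\<close> but lies in every other minimal prime. Its product
  with an element of \<open>p\<close> is therefore in all minimal primes, hence in the radical ideal
  \<open>I\<close>.\<close>

lemma colon_xmon_eq_prime:
  assumes rad: "radical_ideal I" and p: "p \<in> minimal_primes I" "\<And>i. Var i \<notin> p"
    and u: "xmon u \<in> M_ideal p I"
  shows "colon I (xmon u) = p"
proof
  have "xmon u \<notin> p" using xmon_in_prime[OF minimal_primesD(1)[OF p(1)]] p(2) by blast
  then show "colon I (xmon u) \<subseteq> p"
    using prime_type_mult[OF minimal_primesD(1)[OF p(1)]] minimal_primesD(3)[OF p(1)]
    by (auto simp: colon_def)
  show "p \<subseteq> colon I (xmon u)"
  proof
    fix f assume f: "f \<in> p"
    have "f * xmon u \<in> q" if q: "q \<in> minimal_primes I" for q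
    proof (cases "q = p")
      case True
      then show ?thesis using f ideal_type_mult'[OF minimal_primesD(2)[OF q]] by blast
    next
      case False
      then have "xmon u \<in> q" using u q unfolding xmon_in_M_ideal_iff by blast
      then show ?thesis using ideal_type_mult[OF minimal_primesD(2)[OF q]] by blast
    qed
    then show "f \<in> colon I (xmon u)"
      using in_radical_ideal_if_in_minimal_primes[OF rad] by (simp add: colon_def)
  qed
qed

text \<open>The inclusion \<open>sub\<close> is the common target of the radical and the binomial
  case.\<close>

lemma gamma_le_v_number:
  fixes I :: "('n::finite, 'k::field) mpoly set"
  assumes gr: "graded_ideal I" and p: "p \<in> minimal_primes I"
    and sub: "\<Inter>(minimal_primes I - {p}) \<subseteq> I <+>\<^bsub>mpoly_ring\<^esub> M_ideal p I"
  shows "gamma p I \<le> v_number p I"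
  unfolding v_number_def
proof (rule INF_greatest)
  fix d assume "d \<in> {d. \<exists>f\<in>homogeneous d. colon I f = p}"
  then obtain f where f: "f \<in> homogeneous d" "p = colon I f" by blast
  note p_prime = minimal_primesD(1)[OF p]
  have "f \<in> q" if q: "q \<in> minimal_primes I - {p}" for q
  proof -
    have q_min: "q \<in> minimal_primes I" using q by blast
    have "\<not> p \<subseteq> q"
      using minimal_primesD(4)[OF q_min p_prime minimal_primesD(3)[OF p]] q by blast
    \<comment> \<open>An element of \<open>p\<close> outside \<open>q\<close> multiplies
      \<open>f\<close> into \<open>I\<close>, hence into \<open>q\<close>; primality leaves
      \<open>f\<close> in \<open>q\<close>.\<close>
    then obtain h where h: "h \<in> p" "h \<notin> q" by blast
    have "h * f \<in> q" using h(1) f(2) minimal_primesD(3)[OF q_min] by (auto simp: colon_def)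
    then show ?thesis using h(2) prime_type_mult[OF minimal_primesD(1)[OF q_min]] by blast
  qed
  then have "f \<in> I <+>\<^bsub>mpoly_ring\<^esub> M_ideal p I" using sub by blast
  then obtain g m where gm: "g \<in> I" "m \<in> M_ideal p I" "f = g + m"
    by (auto simp: set_add_type_iff)
  \<comment> \<open>Otherwise \<open>f\<close> is the degree \<open>d\<close> component of
    \<open>g\<close>, so it lies in the graded ideal \<open>I\<close> and \<open>colon I f\<close>
    is the whole ring.\<close>
  have "\<exists>u\<in>Poly_Mapping.keys m. mdeg u = d"
  proof (rule ccontr)
    assume "\<not> ?thesis"
    then have "hom_component d m = 0" unfolding hom_component_eq_restrict_keys by (intro restrict_keys_eq_0) auto
    then have "hom_component d f = hom_component d g" by (simp add: gm(3) hom_component_eq_restrict_keys restrict_keys_add)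
    moreover have "hom_component d f = f"
      using f(1) unfolding hom_component_eq_restrict_keys by (intro restrict_keys_eq_self) (auto simp: homogeneous_def)
    ultimately have "f \<in> I" using gr gm(1) unfolding graded_ideal_def by metis
    then have "1 \<in> p" unfolding f(2) by (simp add: colon_def)
    then show False using prime_type_1[OF p_prime] by blast
  qed
  then obtain u where u: "u \<in> Poly_Mapping.keys m" "mdeg u = d" by blast
  then have "xmon u \<in> M_ideal p I"
    using gm(2) unfolding M_ideal_eq_mon_ideal xmon_in_mon_ideal by (auto simp: mon_ideal_def)
  then show "gamma p I \<le> enat d" using u(2) unfolding gamma_def by (intro INF_lower2[of u]) auto
qed

text \<open>Finiteness of \<open>gamma p I\<close>, with the inequality, shows that both infima are
  attained minima.\<close>

theorem theorem3p13:
  fixes I p :: "('n::finite, 'k::field) mpoly set"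
  assumes graded: "graded_ideal I"
    and coord_sat: "coordinate_saturated I"
    and p_min: "p \<in> minimal_primes I"
    and p_novars: "\<forall>i. Var i \<notin> p"
    and p_unique: "\<forall>q\<in>minimal_primes I. (\<forall>i. Var i \<notin> q) \<longrightarrow> q = p"
  shows "p = colon I (\<Prod>i\<in>UNIV. Var i)
    \<and> p \<in> Ass I \<and> gamma p I < \<infinity>
    \<and> v_number p I \<le> gamma p I
    \<and> (radical_ideal (I <+>\<^bsub>mpoly_ring\<^esub> M_ideal p I) \<and> alg_closed_type TYPE('k)
         \<longrightarrow> v_number p I = gamma p I)
    \<and> (alg_closed_type TYPE('k) \<and> binomial_ideal I \<longrightarrow> v_number p I = gamma p I)"
proof -
  let ?J = "\<Inter>(minimal_primes I - {p})"
  note I = coordinate_saturatedD(2)[OF coord_sat]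
  have novars: "Var i \<notin> p" for i using p_novars by blast
  have colon: "p = colon I (\<Prod>i\<in>UNIV. Var i)"
    by (rule prime_eq_colon_prod_Var[OF coord_sat p_min novars])
  have ass: "p \<in> Ass I"
    unfolding Ass_def using colon minimal_primesD(1)[OF p_min] by blast
  have fin: "gamma p I < \<infinity>"
  proof -
    \<comment> \<open>The product of all variables: by uniqueness of \<open>p\<close>, every other
      minimal prime contains some variable and hence this monomial.\<close>
    define u :: "'n \<Rightarrow>\<^sub>0 nat" where "u = (\<Sum>i\<in>UNIV. Poly_Mapping.single i 1)"
    have "xmon u \<in> q" if q: "q \<in> minimal_primes I - {p}" for q
    proof -
      obtain i where i: "Var i \<in> q" using p_unique q by blast
      have "i \<in> Poly_Mapping.keys u"
        by (simp add: u_def in_keys_iff lookup_sum lookup_single when_def)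
      then show ?thesis using q xmon_in_ideal_if_Var[OF minimal_primesD(2) i] by blast
    qed
    then have "xmon u \<in> M_ideal p I" unfolding xmon_in_M_ideal_iff by blast
    then have "gamma p I \<le> enat (mdeg u)" unfolding gamma_def by (intro INF_lower) auto
    also have "\<dots> < \<infinity>" by simp
    finally show ?thesis .
  qed
  have le: "v_number p I \<le> gamma p I"
    unfolding gamma_def
  proof (rule INF_greatest, clarify)
    fix u assume u: "xmon u \<in> M_ideal p I"
    have "xmon u \<in> homogeneous (mdeg u)" by (simp add: homogeneous_def xmon_def)
    then show "v_number p I \<le> enat (mdeg u)"
      using colon_xmon_eq_prime[OF coordinate_saturatedD(1)[OF coord_sat] p_min novars u]
      unfolding v_number_def by (intro INF_lower) blast
  qed
  have M_id: "ideal (M_ideal p I) mpoly_ring" unfolding M_ideal_def by (rule ideal_genideal_type)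
  let ?IM = "I <+>\<^bsub>mpoly_ring\<^esub> M_ideal p I"
  \<comment> \<open>That is, \<open>?J\<close> lies in the radical of \<open>?IM\<close>; each of
    the two cases turns this into \<open>?J\<close> being inside \<open>?IM\<close> itself.\<close>
  have J_sub: "?J \<subseteq> P" if "primeideal P mpoly_ring" "?IM \<subseteq> P" for P
  proof (rule other_minimal_primes_subset_prime[OF coord_sat p_min novars that(1)])
    show "I \<subseteq> P" using in_set_add_left[OF M_id] that(2) by (rule subset_trans)
    show "M_ideal p I \<subseteq> P" using in_set_add_right[OF I] that(2) by (rule subset_trans)
  qed
  have rad: "?J \<subseteq> ?IM" if "radical_ideal ?IM"
  proof
    fix f assume "f \<in> ?J"
    then have "f \<in> q" if "q \<in> minimal_primes ?IM" for q
      using J_sub[OF minimal_primesD(1,3)[OF that]] by blast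
    then show "f \<in> ?IM" by (rule in_radical_ideal_if_in_minimal_primes[OF that])
  qed
  have bin: "?J \<subseteq> ?IM" if "binomial_ideal I"
  proof
    fix f assume f: "f \<in> ?J"
    let ?U = "{u. xmon u \<in> ?J}"
    have U: "up_closed ?U" by (rule up_closed_ideal_exponents) (auto dest: minimal_primesD(2))
    have "f \<in> I <+>\<^bsub>mpoly_ring\<^esub> mon_ideal (rad_exponents (I <+>\<^bsub>mpoly_ring\<^esub> mon_ideal ?U))"
    proof (rule radical_binomial_plus_monomial[OF that coordinate_saturatedD(1)[OF coord_sat] U])
      fix P assume "primeideal P mpoly_ring" "I <+>\<^bsub>mpoly_ring\<^esub> mon_ideal ?U \<subseteq> P"
      then show "f \<in> P" using subsetD[OF J_sub f] unfolding M_ideal_eq_mon_ideal by blast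
    qed
    \<comment> \<open>Each minimal prime other than \<open>p\<close> contains \<open>?IM\<close>, so
      passing to the radical adds no monomials to those of \<open>M\<close>.\<close>
    moreover have "rad_exponents ?IM \<subseteq> ?U"
    proof (intro subsetI CollectI InterI)
      fix u q assume u: "u \<in> rad_exponents ?IM" and "q \<in> minimal_primes I - {p}"
      then have q: "q \<in> minimal_primes I" "q \<noteq> p" by auto
      have "M_ideal p I \<subseteq> q"
        unfolding M_ideal_def using q minimal_primesD(2)[OF q(1)] by (intro genideal_type_least) auto
      then have "?IM \<subseteq> q"
        by (rule set_add_subset_ideal[OF minimal_primesD(2,3)[OF q(1)]])
      then show "xmon u \<in> q" using u minimal_primesD(1)[OF q(1)] by (auto simp: rad_exponents_def)
    qed
    ultimately show "f \<in> ?IM"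
      unfolding M_ideal_eq_mon_ideal set_add_type_iff mon_ideal_def by blast
  qed
  show ?thesis
    using colon ass fin le rad bin gamma_le_v_number[OF graded p_min] by (metis antisym)
qed

end
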